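(* Let $k$ and $\ell$ be positive integers. If $n$ is large enough (depending on $k$ and $\ell$), then one can find $$\left\lfloor \frac{\binom{n}{k}}{\ell}\right\rfloor$$ $(k,\ell)$-papartitions of $[n]=\{1,\dots,n\}$ such that no $k$-element subset of $[n]$ appears (as a member) in two of them, and no two of them are too close to each other.
   Context: A $(k,\ell)$ partial partition, or $(k,\ell)$-papartition, of $[n]$ is a family of $\ell$ pairwise disjoint $k$-element subsets of $[n]$. Two $(k,\ell)$-papartitions $\mathcal{P}$ and $\mathcal{Q}$ are called too close if there exist two distinct members $A_1,B_1\in\mathcal{P}$ and two distinct members $A_2,B_2\in\mathcal{Q}$ such that $|A_1\cap A_2|>\frac{k}{2}$ and $|B_1\cap B_2|>\frac{k}{2}$. *)

theory Defs
  imports Complex_Main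
begin

(* For k > 0 the members of a family of pairwise disjoint k-element sets are automatically
   distinct, so the family can be taken to be a set of sets. *)
definition papartition :: "nat \<Rightarrow> nat \<Rightarrow> nat \<Rightarrow> nat set set \<Rightarrow> bool" where
  "papartition k l n P \<longleftrightarrow>
     card P = l \<and> finite P \<and> (\<forall>A\<in>P. A \<subseteq> {1..n} \<and> card A = k) \<and> pairwise disjnt P"

definition too_close :: "nat \<Rightarrow> nat set set \<Rightarrow> nat set set \<Rightarrow> bool" where
  "too_close k P Q \<longleftrightarrow>
     (\<exists>A1\<in>P. \<exists>B1\<in>P. \<exists>A2\<in>Q. \<exists>B2\<in>Q. A1 \<noteq> B1 \<and> A2 \<noteq> B2 \<and>
        real (card (A1 \<inter> A2)) > real k / 2 \<and> real (card (B1 \<inter> B2)) > real k / 2)"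

end

theory Submission
  imports Defs "HOL-Combinatorics.Transposition"
begin

(* Discard at most l - 1 of the k-sets and colour the rest with colour classes of size l. If a
   k-set A violates one of the requirements, exchange it with some X of another class. All but
   O(n^(k-1)) choices of X create no violation involving A or X: there are O(n^(k-1)) sets meeting
   a given one, and only O(n^((k-1)/2)) sets sharing more than k/2 elements with it, and the latter
   number enters squared. Since (n choose k) has order n^k, a good X exists, and the exchange
   decreases the number of k-sets involved in a violation. This is done twice: first to make all
   classes consist of disjoint sets, then to separate the classes. *)

section \<open>Violations of a colouring and colour exchanges\<close>

text \<open>Colour classes are the prospective papartitions. In the application \<open>R\<close> is
  "meets" and \<open>S\<close> is "shares more than half", so the first disjunct is a failure of
  disjointness inside a class, the second a pair of classes too close to each other. Collecting
  vertices, not pairs or quadruples, gives the set that an exchange shrinks.\<close>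

definition clashing ::
    "'a set \<Rightarrow> ('a \<Rightarrow> 'a \<Rightarrow> bool) \<Rightarrow> ('a \<Rightarrow> 'a \<Rightarrow> bool) \<Rightarrow> ('a \<Rightarrow> 'b) \<Rightarrow> 'a set" where
  "clashing V R S c = {v\<in>V.
     (\<exists>w\<in>V. w \<noteq> v \<and> c w = c v \<and> R v w) \<or>
     (\<exists>w\<in>V. \<exists>v'\<in>V. \<exists>w'\<in>V. w \<noteq> v \<and> c w = c v \<and> w' \<noteq> v' \<and> c w' = c v' \<and> c v' \<noteq> c v \<and>
        S v v' \<and> S w w')}"

lemma clashingI1:
  assumes "v \<in> V" "w \<in> V" "w \<noteq> v" "c w = c v" "R v w"
  shows "v \<in> clashing V R S c"
  using assms unfolding clashing_def by blast

lemma clashingI2: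
  assumes "v \<in> V" "w \<in> V" "v' \<in> V" "w' \<in> V" "w \<noteq> v" "c w = c v" "w' \<noteq> v'" "c w' = c v'"
    "c v' \<noteq> c v" "S v v'" "S w w'"
  shows "v \<in> clashing V R S c"
  using assms unfolding clashing_def by blast

lemma card_UN_le_mult:
  assumes "finite I" "card I \<le> a" "\<And>i. i \<in> I \<Longrightarrow> card (A i) \<le> b"
  shows "card (\<Union>i\<in>I. A i) \<le> a * b"
proof -
  have "card (\<Union>i\<in>I. A i) \<le> (\<Sum>i\<in>I. card (A i))"
    by (rule card_UN_le[OF assms(1)])
  also have "\<dots> \<le> card I * b"
    using sum_bounded_above[of I "\<lambda>i. card (A i)" b] assms(3) by simp
  also have "\<dots> \<le> a * b"
    using assms(2) by simp
  finally show ?thesis .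
qed

locale clash_graphs =
  fixes V :: "'a set" and R S :: "'a \<Rightarrow> 'a \<Rightarrow> bool" and l d D :: nat
  assumes finite_V: "finite V"
    and R_sym: "R v w \<Longrightarrow> R w v"
    and S_sym: "S v w \<Longrightarrow> S w v"
    and S_imp_R: "S v w \<Longrightarrow> R v w"
    and R_degree: "v \<in> V \<Longrightarrow> card {w\<in>V. R v w} \<le> d"
    and S_degree: "v \<in> V \<Longrightarrow> card {w\<in>V. S v w} \<le> D"
    and card_V_gt: "l + 2 * (l * d) + 2 * (l\<^sup>2 * D\<^sup>2) < card V"
begin

text \<open>By counting: the class of \<open>A\<close> and the four sets \<open>F1\<close> to
  \<open>F4\<close> of bad candidates are together smaller than \<open>V\<close>, their bounds being
  the summands of \<open>card_V_gt\<close>. The conclusions exclude violations at \<open>X\<close>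
  once it has joined the class of \<open>A\<close>, and at \<open>A\<close> once it has joined the
  class of \<open>X\<close>.\<close>

lemma exchange_partner:
  fixes c :: "'a \<Rightarrow> 'b"
  assumes A: "A \<in> V"
    and cls: "\<And>v. v \<in> V \<Longrightarrow> card {w\<in>V. c w = c v} \<le> l"
  obtains X where "X \<in> V" "c X \<noteq> c A"
    "\<And>B. B \<in> V \<Longrightarrow> c B = c A \<Longrightarrow> \<not> R B X"
    "\<And>Y. Y \<in> V \<Longrightarrow> c Y = c X \<Longrightarrow> \<not> R A Y"
    "\<And>B B' X'. B \<in> V \<Longrightarrow> B' \<in> V \<Longrightarrow> X' \<in> V \<Longrightarrow> c B = c A \<Longrightarrow> S B B' \<Longrightarrow> c X' = c B' \<Longrightarrow> \<not> S X' X"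
    "\<And>A' Y' Y. A' \<in> V \<Longrightarrow> Y' \<in> V \<Longrightarrow> Y \<in> V \<Longrightarrow> S A A' \<Longrightarrow> c Y' = c A' \<Longrightarrow> S Y' Y \<Longrightarrow> c X \<noteq> c Y"
proof -
  let ?C = "\<lambda>v. {w\<in>V. c w = c v}"
  let ?R = "\<lambda>v. {w\<in>V. R v w}"
  let ?S = "\<lambda>v. {w\<in>V. S v w}"
  have fin: "finite (?C v)" "finite (?R v)" "finite (?S v)" for v
    using finite_V by auto
  \<comment> \<open>\<open>F1\<close> and \<open>F3\<close> trace violations of the two kinds caused
    by \<open>X\<close> in the class of \<open>A\<close>; \<open>F2\<close> and \<open>F4\<close>
    those caused by \<open>A\<close> in the class of \<open>X\<close>, where one bad
    \<open>Y\<close> rules out its whole class. Each walk contributes a factor \<open>l\<close> per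
    class and \<open>d\<close> or \<open>D\<close> per edge.\<close>
  define F1 where "F1 = (\<Union>B\<in>?C A. ?R B)"
  define F2 where "F2 = (\<Union>Y\<in>?R A. ?C Y)"
  define F3 where "F3 = (\<Union>B\<in>?C A. \<Union>B'\<in>?S B. \<Union>X'\<in>?C B'. ?S X')"
  define F4 where "F4 = (\<Union>A'\<in>?S A. \<Union>Y'\<in>?C A'. \<Union>Y\<in>?S Y'. ?C Y)"
  have "card F1 \<le> l * d"
    unfolding F1_def by (intro card_UN_le_mult fin cls R_degree A) auto
  moreover have "card F2 \<le> d * l"
    unfolding F2_def by (intro card_UN_le_mult fin cls R_degree A) auto
  moreover have "card F3 \<le> l * (D * (l * D))"
    unfolding F3_def by (intro card_UN_le_mult fin cls S_degree A) auto
  moreover have "card F4 \<le> D * (l * (D * l))"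
    unfolding F4_def by (intro card_UN_le_mult fin cls S_degree A) auto
  moreover have "card (?C A) \<le> l"
    using cls[OF A] .
  ultimately have "card (?C A) + card F1 + card F2 + card F3 + card F4 < card V"
    using card_V_gt by (simp add: power2_eq_square algebra_simps)
  moreover have "card (?C A \<union> F1 \<union> F2 \<union> F3 \<union> F4) \<le> card (?C A) + card F1 + card F2 + card F3 + card F4"
    by (meson add_mono card_Un_le le_refl order_trans)
  moreover have "finite (?C A \<union> F1 \<union> F2 \<union> F3 \<union> F4)"
    unfolding F1_def F2_def F3_def F4_def using finite_V by auto
  ultimately have "\<not> V \<subseteq> ?C A \<union> F1 \<union> F2 \<union> F3 \<union> F4"
    by (meson card_mono leD le_trans)
  then obtain X where X: "X \<in> V" "X \<notin> ?C A" "X \<notin> F1" "X \<notin> F2" "X \<notin> F3" "X \<notin> F4"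
    by blast
  show thesis
  proof (rule that[OF X(1)])
    show "c X \<noteq> c A" using X(1,2) by simp
    show "\<not> R B X" if "B \<in> V" "c B = c A" for B
      using X(1,3) that unfolding F1_def by blast
    show "\<not> R A Y" if "Y \<in> V" "c Y = c X" for Y
      using X(1,4) that unfolding F2_def by fastforce
    show "\<not> S X' X" if "B \<in> V" "B' \<in> V" "X' \<in> V" "c B = c A" "S B B'" "c X' = c B'" for B B' X'
      using X(1,5) that unfolding F3_def by blast
    show "c X \<noteq> c Y" if "A' \<in> V" "Y' \<in> V" "Y \<in> V" "S A A'" "c Y' = c A'" "S Y' Y" for A' Y' Y
      using X(1,6) that unfolding F4_def by blast
  qed
qed

text \<open>\<open>A\<close> and \<open>X\<close> are both free of violations after the exchange,
  and no other vertex acquires one, so the clashing set loses at least \<open>A\<close>. The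
  invariant \<open>no_S\<close> is needed for violations of the second kind and survives the
  exchange.\<close>

lemma exchange_step:
  fixes c :: "'a \<Rightarrow> 'b"
  assumes A: "A \<in> clashing V R S c"
    and cls: "\<And>v. v \<in> V \<Longrightarrow> card {w\<in>V. c w = c v} \<le> l"
    and no_S: "\<And>v w. v \<in> V \<Longrightarrow> w \<in> V \<Longrightarrow> v \<noteq> w \<Longrightarrow> c v = c w \<Longrightarrow> \<not> S v w"
  obtains X where "X \<in> V"
    "clashing V R S (c \<circ> transpose A X) \<subset> clashing V R S c"
    "\<And>v w. v \<in> V \<Longrightarrow> w \<in> V \<Longrightarrow> v \<noteq> w \<Longrightarrow> (c \<circ> transpose A X) v = (c \<circ> transpose A X) w \<Longrightarrow> \<not> S v w"
proof -
  have AV: "A \<in> V"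
    using A by (simp add: clashing_def)
  obtain X where X: "X \<in> V" "c X \<noteq> c A"
    and X1: "\<And>B. B \<in> V \<Longrightarrow> c B = c A \<Longrightarrow> \<not> R B X"
    and X2: "\<And>Y. Y \<in> V \<Longrightarrow> c Y = c X \<Longrightarrow> \<not> R A Y"
    and X3: "\<And>B B' X'. B \<in> V \<Longrightarrow> B' \<in> V \<Longrightarrow> X' \<in> V \<Longrightarrow> c B = c A \<Longrightarrow> S B B' \<Longrightarrow> c X' = c B' \<Longrightarrow> \<not> S X' X"
    and X4: "\<And>A' Y' Y. A' \<in> V \<Longrightarrow> Y' \<in> V \<Longrightarrow> Y \<in> V \<Longrightarrow> S A A' \<Longrightarrow> c Y' = c A' \<Longrightarrow> S Y' Y \<Longrightarrow> c X \<noteq> c Y"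
    using exchange_partner[OF AV cls] by blast
  define c' where "c' = c \<circ> transpose A X"
  have c'A: "c' A = c X" and c'X: "c' X = c A"
    by (simp_all add: c'_def)
  have c'_eq: "c' v = c v" if "v \<noteq> A" "v \<noteq> X" for v
    using that by (simp add: c'_def)
  have not_S_AX: "\<not> S A X" "\<not> S X A"
    using X1[OF AV refl] S_imp_R S_sym by blast+
  have A_ok: "A \<notin> clashing V R S c'"
  proof
    assume "A \<in> clashing V R S c'"
    then consider w where "w \<in> V" "w \<noteq> A" "c' w = c' A" "R A w"
      | w v' w' where "w \<in> V" "v' \<in> V" "w' \<in> V" "w \<noteq> A" "c' w = c' A" "w' \<noteq> v'" "c' w' = c' v'"
          "c' v' \<noteq> c' A" "S A v'" "S w w'"
      unfolding clashing_def by blast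
    then show False
    proof cases
      case 1
      then show False
        using X(2) X2 c'A c'X c'_eq by metis
    next
      case 2
      have w: "w \<noteq> X" "c w = c X"
        using 2 X(2) c'A c'X c'_eq by metis+
      have "v' \<noteq> A" "w' \<noteq> A" "v' \<noteq> X"
        using 2 not_S_AX by auto
      \<comment> \<open>\<open>w\<close> was in the old class of \<open>X\<close>. The choice of
        \<open>X\<close> gives no control over \<open>S\<close> inside that class; only the
        invariant \<open>no_S\<close> excludes \<open>S w X\<close>. Thus \<open>v'\<close> and
        \<open>w'\<close> keep their old colours, and \<open>X4\<close> applies.\<close>
      moreover have "w' \<noteq> X"
        using no_S[OF \<open>w \<in> V\<close> X(1) w] 2 by blast
      ultimately show False
        using X4[of v' w' w] 2 w c'_eq S_sym by metis
    qed
  qed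
  have X_ok: "X \<notin> clashing V R S c'"
  proof
    assume "X \<in> clashing V R S c'"
    then consider w where "w \<in> V" "w \<noteq> X" "c' w = c' X" "R X w"
      | w v' w' where "w \<in> V" "v' \<in> V" "w' \<in> V" "w \<noteq> X" "c' w = c' X" "w' \<noteq> v'" "c' w' = c' v'"
          "c' v' \<noteq> c' X" "S X v'" "S w w'"
      unfolding clashing_def by blast
    then show False
    proof cases
      case 1
      then show False
        using X(2) X1 c'A c'X c'_eq R_sym by metis
    next
      case 2
      have w: "w \<noteq> A" "c w = c A"
        using 2 X(2) c'A c'X c'_eq by metis+
      have "v' \<noteq> X" "w' \<noteq> X" "v' \<noteq> A"
        using 2 not_S_AX by auto
      moreover have "w' \<noteq> A"
        using no_S[OF \<open>w \<in> V\<close> AV w] 2 by blast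
      ultimately show False
        using X3[of w w' v'] 2 w c'_eq S_sym by metis
    qed
  qed
  \<comment> \<open>By symmetry, all participants in a violation are themselves clashing. Hence no
    violation under \<open>c'\<close> involves \<open>A\<close> or \<open>X\<close>, the only
    vertices whose colours changed, and each one was already present under \<open>c\<close>.\<close>
  have sub: "v \<in> clashing V R S c" if v: "v \<in> clashing V R S c'" for v
  proof -
    have vV: "v \<in> V" and vne: "v \<noteq> A" "v \<noteq> X"
      using v A_ok X_ok by (auto simp: clashing_def)
    from v consider w where "w \<in> V" "w \<noteq> v" "c' w = c' v" "R v w"
      | w v' w' where "w \<in> V" "v' \<in> V" "w' \<in> V" "w \<noteq> v" "c' w = c' v" "w' \<noteq> v'" "c' w' = c' v'"
          "c' v' \<noteq> c' v" "S v v'" "S w w'"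
      unfolding clashing_def by blast
    then show ?thesis
    proof cases
      case 1
      then have "w \<in> clashing V R S c'"
        using vV R_sym by (intro clashingI1[of w V v]) auto
      then have "w \<noteq> A" "w \<noteq> X"
        using A_ok X_ok by auto
      then show ?thesis
        using 1 vV vne c'_eq by (intro clashingI1[of v V w]) auto
    next
      case 2
      have "w \<in> clashing V R S c'"
        using 2 vV by (intro clashingI2[of w V v w' v']) auto
      moreover have "v' \<in> clashing V R S c'"
        using 2 vV S_sym by (intro clashingI2[of v' V w' v w]) auto
      moreover have "w' \<in> clashing V R S c'"
        using 2 vV S_sym by (intro clashingI2[of w' V v' w v]) auto
      ultimately have "w \<notin> {A, X}" "v' \<notin> {A, X}" "w' \<notin> {A, X}"
        using A_ok X_ok by auto
      then have "c w = c v" "c w' = c v'" "c v' \<noteq> c v"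
        using 2 vne c'_eq by auto
      then show ?thesis
        using 2 vV by (intro clashingI2[of v V w v' w']) auto
    qed
  qed
  show thesis
  proof (rule that[OF X(1), folded c'_def])
    show "clashing V R S c' \<subset> clashing V R S c"
      using sub A A_ok by blast
    show "\<not> S v w" if "v \<in> V" "w \<in> V" "v \<noteq> w" "c' v = c' w" for v w
    proof
      assume S: "S v w"
      \<comment> \<open>By \<open>S_imp_R\<close>, a monochromatic \<open>S\<close>-pair is a
        violation of the first kind at both ends, so it avoids \<open>A\<close> and \<open>X\<close>
        and was monochromatic under \<open>c\<close> too.\<close>
      have "v \<in> clashing V R S c'" "w \<in> clashing V R S c'"
        using that S_imp_R[OF S] R_sym
        by (auto intro: clashingI1[of v V w] clashingI1[of w V v])
      then have "v \<notin> {A, X}" "w \<notin> {A, X}"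
        using A_ok X_ok by auto
      then show False
        using no_S[of v w] that S c'_eq by auto
    qed
  qed
qed

text \<open>Exchanges are iterated by induction on the number of clashing vertices. Each merely
  permutes the vertices, so the prescribed class sizes \<open>f\<close> are kept.\<close>

lemma clash_free_colouring:
  fixes c :: "'a \<Rightarrow> 'b"
  assumes cls: "\<And>i. card {v\<in>V. c v = i} = f i" "\<And>i. f i \<le> l"
    and no_S: "\<And>v w. v \<in> V \<Longrightarrow> w \<in> V \<Longrightarrow> v \<noteq> w \<Longrightarrow> c v = c w \<Longrightarrow> \<not> S v w"
  obtains c' where "\<And>i. card {v\<in>V. c' v = i} = f i" "clashing V R S c' = {}"
proof -
  have "\<exists>c'. (\<forall>i. card {v\<in>V. c' v = i} = f i) \<and> clashing V R S c' = {}"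
    using cls(1) no_S
  proof (induction "card (clashing V R S c)" arbitrary: c rule: less_induct)
    case less
    show ?case
    proof (cases "clashing V R S c = {}")
      case True
      then show ?thesis using less.prems(1) by blast
    next
      case False
      then obtain A where A: "A \<in> clashing V R S c" by blast
      have AV: "A \<in> V" using A by (simp add: clashing_def)
      have le: "card {w\<in>V. c w = c v} \<le> l" if "v \<in> V" for v
        using less.prems(1) cls(2) by simp
      obtain X where X: "X \<in> V" "clashing V R S (c \<circ> transpose A X) \<subset> clashing V R S c"
        and X': "\<And>v w. v \<in> V \<Longrightarrow> w \<in> V \<Longrightarrow> v \<noteq> w \<Longrightarrow>
          (c \<circ> transpose A X) v = (c \<circ> transpose A X) w \<Longrightarrow> \<not> S v w"
        using exchange_step[OF A le less.prems(2)] by blast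
      have "finite (clashing V R S c)"
        using finite_V by (simp add: clashing_def)
      then have "card (clashing V R S (c \<circ> transpose A X)) < card (clashing V R S c)"
        using X(2) by (rule psubset_card_mono)
      moreover have "card {v\<in>V. (c \<circ> transpose A X) v = i} = f i" for i
      proof -
        have mem: "transpose A X v \<in> V" if "v \<in> V" for v
          using that AV X(1) by (simp add: transpose_def)
        \<comment> \<open>A transposition is its own inverse, so the preimage of a class is its
          image, of the same cardinality.\<close>
        have "{v\<in>V. (c \<circ> transpose A X) v = i} = transpose A X ` {v\<in>V. c v = i}"
          using mem by (force intro: image_eqI[of _ _ "transpose A X _"])
        then show ?thesis
          using less.prems(1) by (simp add: card_image)
      qed
      ultimately show ?thesis
        using less.hyps X' by blast
    qed
  qed
  then show thesis using that by blast
qed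

end

section \<open>Equal colour classes and counting estimates\<close>

text \<open>Number the vertices from 0 and cut the numbers into consecutive blocks of length
  \<open>l\<close>: the colour is the number divided by \<open>l\<close>.\<close>

lemma equitable_colouring:
  fixes V :: "'a set"
  assumes "finite V" "card V = l * m"
  obtains c :: "'a \<Rightarrow> nat" where "\<And>i. card {v\<in>V. c v = i} = (if i < m then l else 0)"
proof -
  obtain e where e: "bij_betw e V {0..<l * m}"
    using ex_bij_betw_finite_nat[OF assms(1)] assms(2) by auto
  have "card {v\<in>V. e v div l = i} = (if i < m then l else 0)" for i
  proof -
    have "card {v\<in>V. e v div l = i} = card (e ` {v\<in>V. e v div l = i})"
      using e by (intro card_image[symmetric]) (auto simp: bij_betw_def inj_on_def)
    also have "e ` {v\<in>V. e v div l = i} = {x\<in>{0..<l * m}. x div l = i}"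
      using e by (auto simp: bij_betw_def)
    also have "\<dots> = (if i < m then {i * l..<i * l + l} else {})"
    proof (cases "l = 0")
      case False
      have div_iff: "x div l = i \<longleftrightarrow> i * l \<le> x \<and> x < i * l + l" for x
        using False div_nat_eqI[of l i x] by (auto simp: algebra_simps dividend_less_times_div)
      have "i * l + l \<le> l * m" if "i < m"
        using mult_le_mono2[of "Suc i" m l] that by (simp add: algebra_simps)
      moreover have "\<not> x < l * m" if "\<not> i < m" "i * l \<le> x" for x
        using mult_le_mono2[of m i l] that by (metis leD le_trans mult.commute not_less)
      ultimately show ?thesis
        unfolding div_iff by (cases "i < m") auto
    qed simp
    finally show ?thesis by simp
  qed
  then show thesis by (rule that)
qed

text \<open>Such a \<open>B\<close> is determined by a \<open>t\<close>-subset \<open>T\<close> of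
  the intersection and the remaining \<open>k - t\<close> elements. There are at most
  \<open>2 ^ k\<close> choices for \<open>T\<close>, being a subset of \<open>A\<close>, and at most
  \<open>card E ^ (k - t)\<close> for the rest.\<close>

lemma card_large_intersection_le:
  assumes "finite E" "A \<subseteq> E" "card A = k" "t \<le> k"
  shows "card {B. B \<subseteq> E \<and> card B = k \<and> t \<le> card (A \<inter> B)} \<le> 2 ^ k * card E ^ (k - t)"
proof -
  let ?U = "{U. U \<subseteq> E \<and> card U = k - t}"
  have finA: "finite A"
    using assms finite_subset by blast
  have "{B. B \<subseteq> E \<and> card B = k \<and> t \<le> card (A \<inter> B)} \<subseteq> (\<lambda>(T, U). T \<union> U) ` (Pow A \<times> ?U)"
  proof
    fix B assume "B \<in> {B. B \<subseteq> E \<and> card B = k \<and> t \<le> card (A \<inter> B)}"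
    then have B: "B \<subseteq> E" "card B = k" "t \<le> card (A \<inter> B)" by auto
    obtain T where T: "T \<subseteq> A \<inter> B" "card T = t"
      using B(3) obtain_subset_with_card_n by metis
    then have "card (B - T) = k - t"
      using B assms(1) by (metis card_Diff_subset finite_subset le_inf_iff)
    then have "(T, B - T) \<in> Pow A \<times> ?U"
      using T B by auto
    moreover have "B = T \<union> (B - T)"
      using T by auto
    ultimately show "B \<in> (\<lambda>(T, U). T \<union> U) ` (Pow A \<times> ?U)"
      by (metis (mono_tags, lifting) case_prod_conv image_eqI)
  qed
  then have "card {B. B \<subseteq> E \<and> card B = k \<and> t \<le> card (A \<inter> B)} \<le> card (Pow A \<times> ?U)"
    using finA assms(1) by (intro surj_card_le) auto
  also have "\<dots> = 2 ^ k * (card E choose (k - t))"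
    using finA assms n_subsets[of E "k - t"] by (simp add: card_cartesian_product card_Pow)
  also have "\<dots> \<le> 2 ^ k * card E ^ (k - t)"
  proof (cases "k - t \<le> card E")
    case True
    then show ?thesis by (simp add: binomial_le_pow)
  qed (simp add: binomial_eq_0)
  finally show ?thesis .
qed

lemma power_le_binomial_mult:
  assumes "k \<le> n"
  shows "n ^ k \<le> k ^ k * (n choose k)"
proof (cases "k = 0")
  case False
  have "(real n / real k) ^ k \<le> real (n choose k)"
    using binomial_ge_n_over_k_pow_k[OF assms] .
  then have "real (n ^ k) \<le> real (k ^ k * (n choose k))"
    using False by (simp add: power_divide field_simps)
  then show ?thesis
    by (simp only: of_nat_le_iff)
qed simp

text \<open>The binomial coefficient is at least \<open>n ^ k / k ^ k\<close>, so it beats any fixed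
  multiple of \<open>n ^ (k - 1)\<close> for large \<open>n\<close>.\<close>

lemma power_pred_lt_binomial:
  assumes "0 < k" "k \<le> n" "k ^ k * M < n"
  shows "M * n ^ (k - 1) < n choose k"
proof -
  have "k ^ k * (M * n ^ (k - 1)) < n * n ^ (k - 1)"
    using assms by (simp add: mult.assoc[symmetric])
  also have "\<dots> = n ^ k"
    using assms(1) by (simp add: power_eq_if)
  also have "\<dots> \<le> k ^ k * (n choose k)"
    by (rule power_le_binomial_mult[OF assms(2)])
  finally show ?thesis
    by simp
qed

section \<open>Papartitions as colour classes\<close>

theorem theorem2:
  fixes k l :: nat
  assumes "k > 0" and "l > 0"
  shows "\<exists>N. \<forall>n\<ge>N. \<exists>F :: nat set set set.
           finite F \<and> card F = (n choose k) div l \<and>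
           (\<forall>P\<in>F. papartition k l n P) \<and>
           (\<forall>P\<in>F. \<forall>Q\<in>F. P \<noteq> Q \<longrightarrow> P \<inter> Q = {} \<and> \<not> too_close k P Q)"
proof -
  \<comment> \<open>The summands come from \<open>card_V_gt\<close> with powers of \<open>n\<close>
    removed: \<open>2 ^ k\<close> is the constant in both degree bounds, and the second
    \<open>l\<close> in \<open>2 * l\<close> pays for the discarded sets. The threshold below
    ensures both \<open>k \<le> n\<close> and \<open>k ^ k * M < n\<close>.\<close>
  define M where "M = 2 * l + 2 * (l * 2 ^ k) + 2 * (l\<^sup>2 * (2 ^ k)\<^sup>2)"
  show ?thesis
  proof (intro exI[of _ "Suc (k ^ k * M + k)"] allI impI)
    fix n assume n: "Suc (k ^ k * M + k) \<le> n"
    define m where "m = (n choose k) div l"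
    define K where "K = {B. B \<subseteq> {1..n} \<and> card B = k}"
    define R where "R = (\<lambda>A B :: nat set. 1 \<le> card (A \<inter> B))"
    \<comment> \<open>The least integer exceeding \<open>k / 2\<close> is
      \<open>k div 2 + 1\<close>, for either parity of \<open>k\<close>; for positive
      \<open>k\<close> it is at most \<open>k\<close>, as the degree bound requires.\<close>
    define S where "S = (\<lambda>A B :: nat set. k div 2 + 1 \<le> card (A \<inter> B))"
    define d where "d = 2 ^ k * n ^ (k - 1)"
    define D where "D = 2 ^ k * n ^ (k - (k div 2 + 1))"
    have "finite K"
      unfolding K_def by simp
    have "card K = n choose k"
      unfolding K_def using n_subsets[of "{1..n}" k] by simp
    then have "l * m \<le> card K"
      unfolding m_def by simp
    then obtain V where V: "V \<subseteq> K" "card V = l * m" and finV: "finite V"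
      using obtain_subset_with_card_n by metis
    have V_sub: "v \<subseteq> {1..n}" and V_card: "card v = k" if "v \<in> V" for v
      using V(1) that unfolding K_def by auto
    have V_fin: "finite v" if "v \<in> V" for v
      using V_sub[OF that] finite_subset by blast
    have deg: "card {w\<in>V. t \<le> card (v \<inter> w)} \<le> 2 ^ k * n ^ (k - t)" if "v \<in> V" "t \<le> k" for v t
    proof -
      have "card {w\<in>V. t \<le> card (v \<inter> w)} \<le> card {B. B \<subseteq> {1..n} \<and> card B = k \<and> t \<le> card (v \<inter> B)}"
        using V(1) unfolding K_def by (intro card_mono) auto
      also have "\<dots> \<le> 2 ^ k * n ^ (k - t)"
        using card_large_intersection_le[of "{1..n}" v k t] that V_sub V_card by simp
      finally show ?thesis .
    qed
    have R_deg: "card {w\<in>V. R v w} \<le> d" if "v \<in> V" for v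
      unfolding R_def d_def using deg[OF that, of 1] assms(1) by simp
    have S_deg: "card {w\<in>V. S v w} \<le> D" if "v \<in> V" for v
      unfolding S_def D_def using deg[OF that, of "k div 2 + 1"] assms(1) by simp
    have size: "l + 2 * (l * d) + 2 * (l\<^sup>2 * D\<^sup>2) < card V"
    proof -
      \<comment> \<open>This is where "more than half" matters: the square of \<open>D\<close> still
        has order at most \<open>n ^ (k - 1)\<close>. For odd \<open>k\<close> equality
        holds.\<close>
      have "2 * (k - (k div 2 + 1)) \<le> k - 1"
        by presburger
      then have "n ^ (2 * (k - (k div 2 + 1))) \<le> n ^ (k - 1)"
        using n by (intro power_increasing) auto
      then have "D\<^sup>2 \<le> (2 ^ k)\<^sup>2 * n ^ (k - 1)"
        unfolding D_def by (simp add: power_mult_distrib power_mult[symmetric] mult.commute)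
      then have "l\<^sup>2 * D\<^sup>2 \<le> l\<^sup>2 * (2 ^ k)\<^sup>2 * n ^ (k - 1)"
        by (simp add: mult.assoc)
      moreover have "l \<le> l * n ^ (k - 1)"
        using n by simp
      moreover have "M * n ^ (k - 1) =
          2 * (l * n ^ (k - 1)) + 2 * (l * d) + 2 * (l\<^sup>2 * (2 ^ k)\<^sup>2 * n ^ (k - 1))"
        unfolding M_def d_def by (simp add: algebra_simps)
      ultimately have "2 * l + 2 * (l * d) + 2 * (l\<^sup>2 * D\<^sup>2) \<le> M * n ^ (k - 1)"
        by linarith
      also have "\<dots> < n choose k"
        using power_pred_lt_binomial[of k n M] assms(1) n by simp
      also have "\<dots> < l * m + l"
        unfolding m_def using assms(2) by (metis add.commute dividend_less_times_div mult.commute)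
      finally show ?thesis
        using V(2) by simp
    qed
    \<comment> \<open>With the second relation empty, only disjointness inside classes is at stake
      and \<open>no_S\<close> is vacuous. This first pass supplies the starting colouring for the
      second, which uses the real \<open>S\<close>.\<close>
    interpret disj: clash_graphs V R "\<lambda>_ _. False" l d D
      using finV R_deg size by unfold_locales (auto simp: R_def Int_commute)
    interpret close: clash_graphs V R S l d D
      using finV R_deg S_deg size by unfold_locales (auto simp: R_def S_def Int_commute)
    obtain c0 :: "nat set \<Rightarrow> nat" where c0: "\<And>i. card {v\<in>V. c0 v = i} = (if i < m then l else 0)"
      using equitable_colouring[OF finV V(2)] by blast
    have le: "(if i < m then l else 0) \<le> l" for i
      by simp
    obtain c1 :: "nat set \<Rightarrow> nat" where c1: "\<And>i. card {v\<in>V. c1 v = i} = (if i < m then l else 0)"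
      and c1_ok: "clashing V R (\<lambda>_ _. False) c1 = {}"
      using disj.clash_free_colouring[OF c0 le] by blast
    \<comment> \<open>The classes of \<open>c1\<close> consist of disjoint sets, so no two members
      share more than half: this is the invariant with which the second pass starts.\<close>
    have c1_no_S: "\<not> S v w" if "v \<in> V" "w \<in> V" "v \<noteq> w" "c1 v = c1 w" for v w
      using c1_ok that close.S_imp_R[of v w] clashingI1[of v V w c1 R "\<lambda>_ _. False"] by auto
    obtain c :: "nat set \<Rightarrow> nat" where c: "\<And>i. card {v\<in>V. c v = i} = (if i < m then l else 0)"
      and c_ok: "clashing V R S c = {}"
      using close.clash_free_colouring[OF c1 le c1_no_S] by blast
    define G where "G = (\<lambda>i. {v\<in>V. c v = i})"
    have G_card: "card (G i) = l" if "i < m" for i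
      using c that unfolding G_def by simp
    have G_inj: "inj_on G {..<m}"
    proof (rule inj_onI)
      fix i j assume ij: "i \<in> {..<m}" "j \<in> {..<m}" "G i = G j"
      \<comment> \<open>Positivity of \<open>l\<close> makes the classes nonempty, so different
        colours give different families and exactly \<open>m\<close> of them arise.\<close>
      then have "G i \<noteq> {}"
        using G_card assms(2) by fastforce
      then show "i = j"
        using ij(3) unfolding G_def by blast
    qed
    have G_pap: "papartition k l n (G i)" if "i < m" for i
    proof -
      have "disjnt v w" if "v \<in> G i" "w \<in> G i" "v \<noteq> w" for v w
      proof -
        have "\<not> R v w"
          using c_ok that clashingI1[of v V w c R S] unfolding G_def by auto
        then show ?thesis
          using V_fin[of v] that unfolding R_def G_def disjnt_def
          by (simp add: not_le card_eq_0_iff)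
      qed
      then show ?thesis
        using that G_card finV V_sub V_card unfolding papartition_def G_def pairwise_def by auto
    qed
    have G_far: "G i \<inter> G j = {} \<and> \<not> too_close k (G i) (G j)" if "i \<noteq> j" for i j
    proof
      show "G i \<inter> G j = {}"
        using that unfolding G_def by auto
      show "\<not> too_close k (G i) (G j)"
      proof
        have S_iff: "S A B" if "real (card (A \<inter> B)) > real k / 2" for A B
          using that unfolding S_def by linarith
        assume "too_close k (G i) (G j)"
        then obtain A1 B1 A2 B2 where "A1 \<in> G i" "B1 \<in> G i" "A2 \<in> G j" "B2 \<in> G j"
          "A1 \<noteq> B1" "A2 \<noteq> B2" "S A1 A2" "S B1 B2"
          unfolding too_close_def using S_iff by blast
        \<comment> \<open>The witnesses of closeness are exactly a violation of the second kind
          between the classes \<open>i\<close> and \<open>j\<close>.\<close>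
        then have "A1 \<in> clashing V R S c"
          using \<open>i \<noteq> j\<close> unfolding G_def
          by (intro clashingI2[of A1 V B1 A2 B2]) auto
        then show False
          using c_ok by blast
      qed
    qed
    show "\<exists>F :: nat set set set.
           finite F \<and> card F = (n choose k) div l \<and>
           (\<forall>P\<in>F. papartition k l n P) \<and>
           (\<forall>P\<in>F. \<forall>Q\<in>F. P \<noteq> Q \<longrightarrow> P \<inter> Q = {} \<and> \<not> too_close k P Q)"
    proof (intro exI[of _ "G ` {..<m}"] conjI ballI impI)
      show "card (G ` {..<m}) = (n choose k) div l"
        using card_image[OF G_inj] by (simp add: m_def)
      fix P assume "P \<in> G ` {..<m}"
      then obtain i where i: "i < m" "P = G i" by auto
      then show "papartition k l n P"
        using G_pap by simp
      fix Q assume "Q \<in> G ` {..<m}" "P \<noteq> Q"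
      then obtain j where "Q = G j" "i \<noteq> j"
        using i by auto
      then show "P \<inter> Q = {}" "\<not> too_close k P Q"
        using G_far i by simp_all
    qed simp
  qed
qed

end
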